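(* Let $X$ be a real Banach space and let $x^{\ast}\in S_{X^{\ast}}$. Then the following conditions are equivalent: (a) $x^{\ast}$ is a rotund point of $B_{X^{\ast}}$; (b) $x^{\ast}$ is a w*-ALUR point of $B_{X^{\ast}}$ (in the $\lim_m\liminf_n$ sense), i.e. for any sequences $\{x_{n}^{\ast}\}\subseteq B_{X^{\ast}}$ and $\{x_{m}\}\subseteq B_{X}$, the condition $$\lim_{m\rightarrow\infty}\liminf_{n\rightarrow\infty}\left(\frac{x_{n}^{\ast}+x^{\ast}}{2}\right)(x_{m})=1$$ implies w*-$\lim_n x_{n}^{\ast}=x^{\ast}$; (b$^{\prime}$) for any sequence $\{x_{n}^{\ast}\}\subseteq B_{X^{\ast}}$, if the sequence $\{(x_{n}^{\ast}+x^{\ast})/2\}$ is asymptotically normed by $B_{X}$, then w*-$\lim_n x_{n}^{\ast}=x^{\ast}$; (c) for every unbounded nested sequence $\{B_{n}\}$ of balls in $X$ such that $x^{\ast}$ is bounded below on $\bigcup_n B_{n}$, if for any sequence $\{y_{n}^{\ast}\}\subseteq S_{X^{\ast}}$ the sequence $\{\inf y_{n}^{\ast}(B_{n})\}_n$ is bounded below, then w*-$\lim_n y_{n}^{\ast}=x^{\ast}$ (that is, every sequence $\{y_n^{\ast}\}\subseteq S_{X^{\ast}}$ for which $\{\inf y_{n}^{\ast}(B_{n})\}_n$ is bounded below satisfies w*-$\lim_n y_{n}^{\ast}=x^{\ast}$); (d) for every unbounded nested sequence $\{B_{n}\}$ of balls in $X$ such that $x^{\ast}$ is bounded below on $\bigcup_n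 B_{n}$, if $y^{\ast}\in S_{X^{\ast}}$ is also bounded below on $\bigcup_n B_{n}$, then $y^{\ast}=x^{\ast}$; (e) for every unbounded nested sequence $\{B_{n}\}$ of balls in $X$ such that $x^{\ast}$ is bounded below on $\bigcup_n B_{n}$, the set $\bigcup_n B_{n}$ is an affine half-space determined by $x^{\ast}$.
   Context: For a Banach space $X$ with dual $X^{\ast}$, $B_X$ and $S_X$ denote the closed unit ball and the unit sphere of $X$, and $B_{X^{\ast}}$, $S_{X^{\ast}}$ those of $X^{\ast}$. w*-$\lim$ denotes the limit in the weak* topology of $X^{\ast}$. Sequences are indexed by $\{1,2,\dots\}$. Rotund point: $x^{\ast}\in S_{X^{\ast}}$ is a rotund point of $B_{X^{\ast}}$ if, for $y^{\ast}\in X^{\ast}$, $\|y^{\ast}\|=\|(x^{\ast}+y^{\ast})/2\|=1$ implies $y^{\ast}=x^{\ast}$. Asymptotically normed: a sequence $\{z_n^{\ast}\}$ in $B_{X^{\ast}}$ is asymptotically normed by $B_X$ if for every $\varepsilon>0$ there exist $x\in B_X$ and $N\in\mathbb{N}$ such that $z_n^{\ast}(x)>1-\varepsilon$ for all $n\geq N$. Unbounded nested sequence of balls: a sequence $\{B_n=B(x_n,r_n)\}$ of open balls in $X$ (centre $x_n$, radius $r_n>0$) that is increasing ($B_n\subseteq B_{n+1}$ for all $n$) and such that $r_n\uparrow\infty$. A functional $z^{\ast}\in X^{\ast}$ is bounded below on a set $A\subseteq X$ if $\inf z^{\ast}(A):=\inf_{x\in A}z^{\ast}(x)>-\infty$.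 An (open) affine half-space determined by $x^{\ast}$ is a set of the form $\{x\in X: x^{\ast}(x)>\alpha\}$ with $\alpha\in\mathbb{R}$. *)

theory Defs
  imports "HOL-Analysis.Analysis"
begin

text \<open>
  The dual of \<open>X = 'a\<close> is \<open>'a \<Rightarrow>\<^sub>L real\<close> with the operator norm. The strong operator topology on
  operators into the scalar field is the topology of pointwise convergence, i.e. the weak* topology.
\<close>

abbreviation weak_star_topology :: "('a::real_normed_vector \<Rightarrow>\<^sub>L real) topology"
  where "weak_star_topology \<equiv> strong_operator_topology"

lemma limitin_weak_star_iff:
  fixes f :: "'i \<Rightarrow> ('a::real_normed_vector \<Rightarrow>\<^sub>L real)"
  shows "limitin weak_star_topology f l F \<longleftrightarrow> (\<forall>x. ((\<lambda>i. blinfun_apply (f i) x) \<longlongrightarrow> blinfun_apply l x) F)"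
proof -
  have "limitin weak_star_topology f l F
      \<longleftrightarrow> limitin euclidean (\<lambda>i. blinfun_apply (f i)) (blinfun_apply l) F"
    unfolding limitin_def strong_operator_topology_def openin_pullback_topology
      topspace_pullback_topology by auto
  also have "\<dots> \<longleftrightarrow> (\<forall>x. ((\<lambda>i. blinfun_apply (f i) x) \<longlongrightarrow> blinfun_apply l x) F)"
    unfolding euclidean_product_topology[symmetric] limitin_componentwise by simp
  finally show ?thesis .
qed

definition rotund_point :: "'b::real_normed_vector \<Rightarrow> bool"
  where "rotund_point x \<longleftrightarrow>
    x \<in> sphere 0 1 \<and> (\<forall>y. norm y = 1 \<and> norm ((1/2) *\<^sub>R (x + y)) = 1 \<longrightarrow> y = x)"

definition asymptotically_normed :: "(nat \<Rightarrow> ('a::real_normed_vector \<Rightarrow>\<^sub>L real)) \<Rightarrow> bool"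
  where "asymptotically_normed z \<longleftrightarrow>
    range z \<subseteq> cball 0 1 \<and> (\<forall>\<epsilon>>0. \<exists>x\<in>cball 0 1. \<exists>N. \<forall>n\<ge>N. blinfun_apply (z n) x > 1 - \<epsilon>)"

text \<open>The lower limit is taken in \<open>ereal\<close>, where it always exists.\<close>

definition weak_star_ALUR_point :: "('a::real_normed_vector \<Rightarrow>\<^sub>L real) \<Rightarrow> bool"
  where "weak_star_ALUR_point x' \<longleftrightarrow>
    (\<forall>(y :: nat \<Rightarrow> ('a \<Rightarrow>\<^sub>L real)) (x :: nat \<Rightarrow> 'a).
      range y \<subseteq> cball 0 1 \<and> range x \<subseteq> cball 0 1 \<and>
      (\<lambda>m. liminf (\<lambda>n. ereal (blinfun_apply ((1/2) *\<^sub>R (y n + x')) (x m)))) \<longlonglongrightarrow> 1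
      \<longrightarrow> limitin weak_star_topology y x' sequentially)"

definition unbounded_nested_balls :: "(nat \<Rightarrow> 'a::real_normed_vector set) \<Rightarrow> bool"
  where "unbounded_nested_balls B \<longleftrightarrow>
    (\<exists>c r. (\<forall>n. r n > 0 \<and> B n = ball (c n) (r n)) \<and> incseq B \<and>
       incseq r \<and> filterlim r at_top sequentially)"

text \<open>The infimum is taken in \<open>ereal\<close>, since an infimum in \<open>real\<close> is never \<open>-\<infinity>\<close>.\<close>

definition bounded_below_on :: "('a::real_normed_vector \<Rightarrow>\<^sub>L real) \<Rightarrow> 'a set \<Rightarrow> bool"
  where "bounded_below_on z A \<longleftrightarrow> (INF x\<in>A. ereal (blinfun_apply z x)) > -\<infinity>"

lemma bounded_below_on_iff:
  "bounded_below_on z A \<longleftrightarrow> bdd_below (blinfun_apply z ` A)"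
proof
  assume "bounded_below_on z A"
  then obtain M where M: "ereal M < (INF x\<in>A. ereal (blinfun_apply z x))"
    unfolding bounded_below_on_def using less_ereal.simps ereal_dense2 by blast
  have "M \<le> blinfun_apply z x" if "x \<in> A" for x
    using less_le_trans[OF M INF_lower[OF that]] by simp
  then show "bdd_below (blinfun_apply z ` A)" by (auto simp: bdd_below_def)
next
  assume "bdd_below (blinfun_apply z ` A)"
  then obtain M where "\<forall>x\<in>A. M \<le> blinfun_apply z x" by (auto simp: bdd_below_def)
  then have "ereal M \<le> (INF x\<in>A. ereal (blinfun_apply z x))" by (intro INF_greatest) auto
  then show "bounded_below_on z A" unfolding bounded_below_on_def
    using less_le_trans[of "-\<infinity>" "ereal M"] by simp
qed

definition affine_half_space :: "('a::real_normed_vector \<Rightarrow>\<^sub>L real) \<Rightarrow> 'a set \<Rightarrow> bool"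
  where "affine_half_space x' H \<longleftrightarrow> (\<exists>\<alpha>::real. H = {x. blinfun_apply x' x > \<alpha>})"

end

theory Submission
  imports Defs
begin

text \<open>
  The equivalence is proved along the cycle (a), (b'), (c), (e), (d), (a). A weak* cluster point \<open>l\<close>
  of a sequence \<open>y n\<close> with asymptotically normed midpoints satisfies
  \<open>norm ((1/2) *\<^sub>R (x' + l)) = 1\<close>, so rotundity forces \<open>l = x'\<close>. Uniform lower bounds on an unbounded
  nested sequence of balls make the midpoints asymptotically normed by the rescaled centres.
  Separating a point outside the union from each ball, the functionals converge to \<open>x'\<close>, so the union
  is a half-space. A functional bounded below on a half-space is a nonnegative multiple of the one
  determining it. Finally, if \<open>norm ((1/2) *\<^sub>R (x' + y)) = 1\<close>, summing almost norming vectors gives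
  balls on which both \<open>x'\<close> and \<open>y\<close> are bounded below.
\<close>

section \<open>Hahn--Banach: norming functionals\<close>

definition sublinear :: "('a::real_vector \<Rightarrow> real) \<Rightarrow> bool"
  where "sublinear q \<longleftrightarrow>
    (\<forall>x y. q (x + y) \<le> q x + q y) \<and> (\<forall>c x. 0 \<le> c \<longrightarrow> q (c *\<^sub>R x) = c * q x)"

lemma sublinear_add: "sublinear q \<Longrightarrow> q (x + y) \<le> q x + q y"
  by (simp add: sublinear_def)

lemma sublinear_scaleR: "sublinear q \<Longrightarrow> 0 \<le> c \<Longrightarrow> q (c *\<^sub>R x) = c * q x"
  by (simp add: sublinear_def)

lemma sublinear_zero: "sublinear q \<Longrightarrow> q 0 = 0"
  using sublinear_scaleR[of q 0 0] by simp

lemma sublinear_minus: "sublinear q \<Longrightarrow> - q (- x) \<le> q x"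
  using sublinear_add[of q x "- x"] sublinear_zero[of q] by simp

lemma sublinear_norm: "sublinear norm"
  by (simp add: sublinear_def norm_triangle_ineq)

text \<open>Scaling back by \<open>1 / c\<close> gives the reverse inequality.\<close>

lemma sublinearI:
  assumes add: "\<And>x y. q (x + y) \<le> q x + q y"
    and zero: "q 0 = 0"
    and scale: "\<And>c x. 0 < c \<Longrightarrow> q (c *\<^sub>R x) \<le> c * q x"
  shows "sublinear q"
proof -
  have "q (c *\<^sub>R x) = c * q x" if "0 \<le> c" for c x
  proof (cases "c = 0")
    case False
    with that have c: "0 < c" by simp
    have "q x \<le> (1 / c) * q (c *\<^sub>R x)"
      using scale[of "1 / c" "c *\<^sub>R x"] c by simp
    then have "c * q x \<le> q (c *\<^sub>R x)"
      using c by (simp add: field_simps)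
    then show ?thesis using scale[OF c, of x] by simp
  qed (simp add: zero)
  then show ?thesis by (simp add: sublinear_def add)
qed

text \<open>The infimum \<open>q'\<close> of \<open>q (x + t *\<^sub>R a) - t * q a\<close> over
  \<open>t \<ge> 0\<close> works: \<open>t = 0\<close> puts it below \<open>q\<close>, and
  \<open>t = 1\<close> gives the bound at \<open>- a\<close>.\<close>

lemma sublinear_below_odd_at:
  fixes q :: "'a::real_vector \<Rightarrow> real"
  assumes q: "sublinear q"
  obtains q' where "sublinear q'" "q' \<le> q" "q' (- a) \<le> - q a"
proof -
  define g where "g x t = q (x + t *\<^sub>R a) - t * q a" for x t
  define q' where "q' x = (INF t\<in>{0..}. g x t)" for x
  \<comment> \<open>Since \<open>t * q a = q (t *\<^sub>R a) \<le> q (x + t *\<^sub>R a) + q (-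
    x)\<close>, this bound is free of \<open>t\<close> and the infimum is a genuine one.\<close>
  have "- q (- x) \<le> g x t" if "0 \<le> t" for x t
    using sublinear_add[OF q, of "x + t *\<^sub>R a" "- x"] sublinear_scaleR[OF q that, of a]
    by (simp add: g_def)
  then have "bdd_below (g x ` {0..})" for x
    by (intro bdd_belowI[of _ "- q (- x)"]) auto
  then have lower: "q' x \<le> g x t" if "0 \<le> t" for x t
    using that unfolding q'_def by (intro cINF_lower) auto
  have greatest: "m \<le> q' x" if "\<And>t. 0 \<le> t \<Longrightarrow> m \<le> g x t" for m x
    unfolding q'_def using that by (intro cINF_greatest) auto
  have "sublinear q'"
  proof (rule sublinearI)
    fix x y
    \<comment> \<open>The parameter \<open>s + t\<close> competes for \<open>x + y\<close>; the two
      infima are then taken one after the other.\<close>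
    have "q' (x + y) - g x s \<le> g y t" if "0 \<le> s" "0 \<le> t" for s t
      using lower[of "s + t" "x + y"] sublinear_add[OF q, of "x + s *\<^sub>R a" "y + t *\<^sub>R a"] that
      by (simp add: g_def algebra_simps)
    then have "q' (x + y) - q' y \<le> g x s" if "0 \<le> s" for s
      using greatest[of "q' (x + y) - g x s" y] that by fastforce
    then show "q' (x + y) \<le> q' x + q' y"
      using greatest[of "q' (x + y) - q' y" x] by fastforce
  next
    have "g 0 t = 0" if "0 \<le> t" for t
      using that by (simp add: g_def sublinear_scaleR[OF q])
    then show "q' 0 = 0"
      using lower[of 0 0] greatest[of 0 0] by fastforce
  next
    fix c :: real and x
    assume c: "0 < c"
    have "q' (c *\<^sub>R x) / c \<le> g x t" if "0 \<le> t" for t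
    proof -
      have "q' (c *\<^sub>R x) \<le> g (c *\<^sub>R x) (c * t)"
        using lower c that by simp
      also have "\<dots> = c * g x t"
        using sublinear_scaleR[OF q, of c "x + t *\<^sub>R a"] c by (simp add: g_def algebra_simps)
      finally show ?thesis using c by (simp add: field_simps)
    qed
    then have "q' (c *\<^sub>R x) / c \<le> q' x" by (rule greatest)
    then show "q' (c *\<^sub>R x) \<le> c * q' x" using c by (simp add: field_simps)
  qed
  moreover have "q' \<le> q"
    using lower[of 0] by (auto simp: le_fun_def g_def)
  moreover have "q' (- a) \<le> - q a"
    using lower[of 1 "- a"] by (simp add: g_def sublinear_zero[OF q])
  ultimately show ?thesis by (rule that)
qed

text \<open>The pointwise infimum is finite because
  \<open>- p (- x) \<le> - q (- x) \<le> q x\<close>. Subadditivity survives because two members of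
  a chain can be replaced by the smaller one.\<close>

lemma sublinear_INF_chain:
  fixes C :: "('a::real_vector \<Rightarrow> real) set"
  assumes ne: "C \<noteq> {}"
    and sub: "\<And>q. q \<in> C \<Longrightarrow> sublinear q"
    and le: "\<And>q. q \<in> C \<Longrightarrow> q \<le> p"
    and chain: "\<And>q r. q \<in> C \<Longrightarrow> r \<in> C \<Longrightarrow> q \<le> r \<or> r \<le> q"
  obtains u where "sublinear u" "\<And>q. q \<in> C \<Longrightarrow> u \<le> q"
proof -
  define u where "u x = (INF q\<in>C. q x)" for x
  have "- p (- x) \<le> q x" if "q \<in> C" for q x
    using sublinear_minus[OF sub[OF that], of x] le_funD[OF le[OF that], of "- x"] by linarith
  then have "bdd_below ((\<lambda>q. q x) ` C)" for x
    by (intro bdd_belowI[of _ "- p (- x)"]) auto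
  then have lower: "u x \<le> q x" if "q \<in> C" for q x
    using that unfolding u_def by (intro cINF_lower) auto
  have greatest: "m \<le> u x" if "\<And>q. q \<in> C \<Longrightarrow> m \<le> q x" for m x
    unfolding u_def using that ne by (intro cINF_greatest) auto
  have "sublinear u"
  proof (rule sublinearI)
    fix x y
    have "u (x + y) - q x \<le> r y" if qr: "q \<in> C" "r \<in> C" for q r
    proof -
      obtain s where "s \<in> C" "s \<le> q" "s \<le> r"
        using chain[OF qr] qr by blast
      then show ?thesis
        using lower[of s "x + y"] sublinear_add[OF sub, of s x y] le_funD[of s q x] le_funD[of s r y]
        by linarith
    qed
    then have "u (x + y) - u y \<le> q x" if "q \<in> C" for q
      using greatest[of "u (x + y) - q x" y] that by fastforce
    then show "u (x + y) \<le> u x + u y"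
      using greatest[of "u (x + y) - u y" x] by fastforce
  next
    show "u 0 = 0" by (simp add: u_def sublinear_zero sub ne)
  next
    fix c :: real and x
    assume c: "0 < c"
    have "u (c *\<^sub>R x) / c \<le> q x" if "q \<in> C" for q
      using lower[OF that, of "c *\<^sub>R x"] sublinear_scaleR[OF sub[OF that], of c x] c
      by (simp add: field_simps)
    then have "u (c *\<^sub>R x) / c \<le> u x" by (rule greatest)
    then show "u (c *\<^sub>R x) \<le> c * u x" using c by (simp add: field_simps)
  qed
  then show ?thesis using lower by (intro that) (auto simp: le_fun_def)
qed

text \<open>Oddness turns \<open>q x \<le> q (x + y) + q (- y)\<close> into superadditivity and
  extends homogeneity to negative scalars.\<close>

lemma linear_if_sublinear_odd:
  assumes q: "sublinear q" and odd: "\<And>x. q (- x) \<le> - q x"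
  shows "linear q"
proof
  have minus: "q (- x) = - q x" for x
    using odd[of x] sublinear_minus[OF q, of x] by simp
  show "q (x + y) = q x + q y" for x y
    using sublinear_add[OF q, of x y] sublinear_add[OF q, of "x + y" "- y"] minus[of y] by simp
  show "q (c *\<^sub>R x) = c *\<^sub>R q x" for c x
  proof (cases "0 \<le> c")
    case False
    then show ?thesis
      using sublinear_scaleR[OF q, of "- c" x] minus[of "c *\<^sub>R x"] by simp
  qed (simp add: sublinear_scaleR[OF q])
qed

text \<open>A minimal sublinear functional below \<open>p\<close> is odd by \<open>sublinear_below_odd_at\<close>, hence linear.\<close>

lemma hahn_banach_sublinear:
  fixes p :: "'a::real_vector \<Rightarrow> real"
  assumes p: "sublinear p"
  obtains f where "linear f" "f \<le> p" "f a = p a"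
proof -
  \<comment> \<open>Zorn's lemma runs below \<open>p'\<close> instead of \<open>p\<close>: a linear
    \<open>m \<le> p'\<close> satisfies \<open>- m a \<le> p' (- a) \<le> - p a\<close>, which
    together with \<open>m \<le> p\<close> gives \<open>m a = p a\<close>.\<close>
  obtain p' where p': "sublinear p'" "p' \<le> p" "p' (- a) \<le> - p a"
    using sublinear_below_odd_at[OF p] by blast
  define A where "A = {q. sublinear q \<and> q \<le> p'}"
  have "\<exists>m\<in>A. \<forall>q\<in>A. q \<le> m \<longrightarrow> q = m"
  \<comment> \<open>The order is reversed, so the maximal element is a minimal sublinear functional
    below \<open>p'\<close>.\<close>
  proof (rule predicate_Zorn)
    show "partial_order_on A (relation_of (\<lambda>q r. r \<le> q) A)"
      by (rule partial_order_on_relation_ofI) auto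
    fix C assume "C \<in> Chains (relation_of (\<lambda>q r. r \<le> q) A)"
    then have C: "q \<in> A \<and> r \<in> A \<and> (q \<le> r \<or> r \<le> q)" if "q \<in> C" "r \<in> C" for q r
      using that unfolding Chains_def relation_of_def by blast
    show "\<exists>u\<in>A. \<forall>q\<in>C. u \<le> q"
    proof (cases "C = {}")
      case False
      then obtain u where u: "sublinear u" "\<And>q. q \<in> C \<Longrightarrow> u \<le> q"
        using sublinear_INF_chain[of C p'] C unfolding A_def by blast
      obtain q where "q \<in> C" using False by blast
      then have "u \<le> p'" using u(2)[of q] C[of q q] unfolding A_def by (auto intro: order_trans)
      then show ?thesis using u unfolding A_def by blast
    qed (use p' in \<open>auto simp: A_def\<close>)
  qed
  then obtain m where m: "sublinear m" "m \<le> p'"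
    and min: "\<And>q. sublinear q \<Longrightarrow> q \<le> p' \<Longrightarrow> q \<le> m \<Longrightarrow> q = m"
    unfolding A_def by blast
  \<comment> \<open>Minimality forces the functional lowered in direction \<open>x\<close> to equal
    \<open>m\<close>.\<close>
  have "m (- x) \<le> - m x" for x
  proof -
    obtain q where "sublinear q" "q \<le> m" "q (- x) \<le> - m x"
      using sublinear_below_odd_at[OF m(1)] by blast
    then show ?thesis using min[of q] m(2) order_trans by blast
  qed
  then have lin: "linear m" by (rule linear_if_sublinear_odd[OF m(1)])
  have "- m a \<le> - p a"
    using p'(3) le_funD[OF m(2), of "- a"] linear_neg[OF lin, of a] by linarith
  moreover have "m \<le> p" using m(2) p'(2) by (rule order_trans)
  ultimately show ?thesis
    using that[OF lin] le_funD[of m p a] by force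
qed

lemma norming_functional:
  fixes a :: "'a::real_normed_vector"
  assumes "a \<noteq> 0"
  obtains f :: "'a \<Rightarrow>\<^sub>L real" where "norm f = 1" "blinfun_apply f a = norm a"
proof -
  obtain f where f: "linear f" "f \<le> norm" "f a = norm a"
    using hahn_banach_sublinear[OF sublinear_norm] by blast
  have bound: "norm (f x) \<le> 1 * norm x" for x
    using le_funD[OF f(2), of x] le_funD[OF f(2), of "- x"] linear_neg[OF f(1), of x] by simp
  then have "bounded_linear f"
    using f(1) by (intro bounded_linear_intro[of f 1]) (auto simp: linear_add linear_scale mult.commute)
  then have F: "blinfun_apply (Blinfun f) = f" by (rule bounded_linear_Blinfun_apply)
  have "norm (Blinfun f) \<le> 1"
    using bound by (intro norm_blinfun_bound) (auto simp: F)
  moreover have "norm a \<le> norm (Blinfun f) * norm a"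
    using norm_blinfun[of "Blinfun f" a] f(3) by (simp add: F)
  ultimately show ?thesis
    using that[of "Blinfun f"] assms f(3) F by simp
qed

section \<open>Weak* compactness of the dual ball\<close>

text \<open>If \<open>f\<close> clusters at \<open>N\<close> along \<open>F\<close>, the refinement
  of \<open>F\<close> along which \<open>f\<close> converges to \<open>N\<close> is proper; it plays
  the role of a subnet.\<close>

lemma filtermap_inf_filtercomap_neq_bot:
  assumes "inf N (filtermap f F) \<noteq> bot"
  shows "inf F (filtercomap f N) \<noteq> bot"
proof
  assume "inf F (filtercomap f N) = bot"
  then obtain P Q where PQ: "eventually P F" "eventually Q N" "\<And>x. P x \<Longrightarrow> Q (f x) \<Longrightarrow> False"
    unfolding trivial_limit_def eventually_inf eventually_filtercomap by blast
  have "eventually (\<lambda>y. \<not> Q y) (filtermap f F)"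
    unfolding eventually_filtermap using PQ(1) by (rule eventually_mono) (use PQ(3) in blast)
  with PQ(2) have "eventually (\<lambda>_. False) (inf N (filtermap f F))"
    unfolding eventually_inf by blast
  with assms show False by simp
qed

text \<open>Banach-Alaoglu in filter form, by Tychonoff in the product of the intervals
  \<open>cball 0 (norm x)\<close>. Without separability a bounded sequence of functionals may have
  no weak* convergent subsequence, hence the subfilter.\<close>

lemma banach_alaoglu_subfilter:
  fixes y :: "'i \<Rightarrow> ('a::real_normed_vector \<Rightarrow>\<^sub>L real)"
  assumes F: "F \<noteq> bot" and y: "\<And>i. norm (y i) \<le> 1"
  obtains l G where "G \<noteq> bot" "G \<le> F" "norm l \<le> 1"
    "\<And>x. ((\<lambda>i. blinfun_apply (y i) x) \<longlongrightarrow> blinfun_apply l x) G"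
proof -
  define K where "K = (\<Pi>\<^sub>E x\<in>(UNIV :: 'a set). cball (0::real) (norm x))"
  have "compactin (product_topology (\<lambda>_. euclidean) UNIV) K"
    unfolding K_def compactin_PiE by simp
  then have K: "compact K" by (simp add: euclidean_product_topology)
  have "\<bar>blinfun_apply (y i) x\<bar> \<le> norm x" for i x
    using norm_blinfun[of "y i" x] mult_right_mono[OF y norm_ge_zero, of i x] by simp
  then have "eventually (\<lambda>g. g \<in> K) (filtermap (\<lambda>i. blinfun_apply (y i)) F)"
    by (simp add: eventually_filtermap K_def PiE_iff)
  moreover have "filtermap (\<lambda>i. blinfun_apply (y i)) F \<noteq> bot"
    using F by (simp add: filtermap_bot_iff)
  ultimately obtain f where f: "f \<in> K"
    and "inf (nhds f) (filtermap (\<lambda>i. blinfun_apply (y i)) F) \<noteq> bot"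
    using K unfolding compact_filter by blast
  define G where "G = inf F (filtercomap (\<lambda>i. blinfun_apply (y i)) (nhds f))"
  have G: "G \<noteq> bot"
    unfolding G_def by (rule filtermap_inf_filtercomap_neq_bot) fact
  have "filterlim (\<lambda>i. blinfun_apply (y i)) (nhds f) G"
    unfolding G_def by (rule filterlim_mono[OF filterlim_filtercomap]) auto
  then have lim: "((\<lambda>i. blinfun_apply (y i) x) \<longlongrightarrow> f x) G" for x
    using continuous_on_tendsto_compose[OF continuous_on_product_coordinates] by fastforce
  have bound: "norm (f x) \<le> norm x * 1" for x
    using f by (simp add: K_def PiE_iff)
  have "bounded_linear f"
  proof (rule bounded_linear_intro)
    show "f (x + z) = f x + f z" for x z
      using tendsto_add[OF lim[of x] lim[of z]] lim[of "x + z"] G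
      by (auto simp: blinfun.add_right intro: tendsto_unique)
    show "f (c *\<^sub>R x) = c *\<^sub>R f x" for c x
      using tendsto_scaleR[OF tendsto_const lim[of x]] lim[of "c *\<^sub>R x"] G
      by (auto simp: blinfun.scaleR_right intro: tendsto_unique)
  qed (rule bound)
  then have apply_f: "blinfun_apply (Blinfun f) = f" by (rule bounded_linear_Blinfun_apply)
  have "norm (Blinfun f) \<le> 1"
    using bound by (intro norm_blinfun_bound) (auto simp: apply_f)
  then show ?thesis using that[OF G, of "Blinfun f"] lim by (simp add: apply_f G_def)
qed

section \<open>Functionals on balls\<close>

text \<open>If \<open>f \<le> m\<close> held on the unit ball, normalising \<open>x\<close> and
  \<open>- x\<close> would bound \<open>norm f\<close> by \<open>m\<close>. For negative
  \<open>m\<close> the vector \<open>0\<close> serves.\<close>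

lemma exists_almost_norming:
  fixes f :: "'a::real_normed_vector \<Rightarrow>\<^sub>L real"
  assumes "m < norm f"
  obtains x where "norm x \<le> 1" "m < blinfun_apply f x"
proof (cases "m < 0")
  case True
  then show ?thesis using that[of 0] by simp
next
  case False
  have "\<exists>x. norm x \<le> 1 \<and> m < blinfun_apply f x"
  proof (rule ccontr)
    assume none: "\<not> ?thesis"
    have "norm (blinfun_apply f x) \<le> m * norm x" for x
    proof (cases "x = 0")
      case False
      then have "norm ((1 / norm x) *\<^sub>R x) \<le> 1" "norm ((1 / norm x) *\<^sub>R (- x)) \<le> 1" by auto
      then have "blinfun_apply f ((1 / norm x) *\<^sub>R x) \<le> m"
        "blinfun_apply f ((1 / norm x) *\<^sub>R (- x)) \<le> m"
        using none by (meson not_less)+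
      then have "blinfun_apply f x \<le> m * norm x" "- blinfun_apply f x \<le> m * norm x"
        using False by (auto simp: blinfun.scaleR_right blinfun.minus_right field_simps)
      then show ?thesis by simp
    qed simp
    then have "norm f \<le> m" using False by (intro norm_blinfun_bound) auto
    with assms show False by simp
  qed
  then show ?thesis using that by blast
qed

lemma blinfun_le_norm:
  fixes f :: "'a::real_normed_vector \<Rightarrow>\<^sub>L real"
  assumes "norm f \<le> 1"
  shows "blinfun_apply f x \<le> norm x"
  using norm_blinfun[of f x] mult_right_mono[OF assms norm_ge_zero, of x] by simp

lemma blinfun_lower_bound_ball:
  fixes f :: "'a::real_normed_vector \<Rightarrow>\<^sub>L real"
  assumes "norm f \<le> 1" "z \<in> ball c r"
  shows "blinfun_apply f c - r \<le> blinfun_apply f z"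
  using blinfun_le_norm[OF assms(1), of "c - z"] assms(2) by (simp add: blinfun.diff_right dist_norm)

text \<open>Otherwise an almost norming \<open>x\<close> pushes the value at
  \<open>c - r *\<^sub>R x\<close> below \<open>m\<close>. This point may lie on the boundary, hence
  the passage to the closure.\<close>

lemma blinfun_center_ge:
  fixes f :: "'a::real_normed_vector \<Rightarrow>\<^sub>L real"
  assumes f: "norm f = 1" and r: "0 < r" and m: "\<And>z. z \<in> ball c r \<Longrightarrow> m \<le> blinfun_apply f z"
  shows "m + r \<le> blinfun_apply f c"
proof (rule ccontr)
  assume "\<not> ?thesis"
  then have "(blinfun_apply f c - m) / r < norm f" using r f by (simp add: field_simps)
  then obtain x where x: "norm x \<le> 1" "(blinfun_apply f c - m) / r < blinfun_apply f x"
    by (rule exists_almost_norming)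
  have "r * norm x \<le> r" using x(1) r by simp
  then have "c - r *\<^sub>R x \<in> closure (ball c r)" using r by (simp add: dist_norm)
  with linear_continuous_on[OF blinfun.bounded_linear_right]
  have "m \<le> blinfun_apply f (c - r *\<^sub>R x)"
    by (rule continuous_ge_on_closure) (rule m)
  then show False
    using x(2) r by (simp add: blinfun.diff_right blinfun.scaleR_right field_simps)
qed

text \<open>A ball of radius \<open>s\<close> around \<open>w\<close> still fits, and the estimate
  at its centre leaves the positive gap \<open>s\<close>.\<close>

lemma blinfun_gt_Inf_ball:
  fixes f :: "'a::real_normed_vector \<Rightarrow>\<^sub>L real"
  assumes f: "norm f = 1" and w: "w \<in> ball c r" and m: "\<And>z. z \<in> ball c r \<Longrightarrow> m \<le> blinfun_apply f z"
  shows "m < blinfun_apply f w"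
proof -
  define s where "s = r - dist c w"
  have s: "0 < s" using w by (simp add: s_def)
  have "z \<in> ball c r" if "z \<in> ball w s" for z
    using that dist_triangle[of c z w] by (simp add: s_def)
  then show ?thesis using blinfun_center_ge[OF f s, of w m] m s by fastforce
qed

section \<open>Rotund points and nested balls\<close>

lemma norm_half_add_le:
  fixes x y :: "'a::real_normed_vector"
  assumes "norm x \<le> 1" "norm y \<le> 1"
  shows "norm ((1/2) *\<^sub>R (x + y)) \<le> 1"
  using norm_triangle_ineq[of x y] assms by simp

lemma rotund_point_asymptotically_normed:
  fixes x' :: "'a::real_normed_vector \<Rightarrow>\<^sub>L real"
  assumes rot: "rotund_point x'" and y: "range y \<subseteq> cball 0 1"
    and asym: "asymptotically_normed (\<lambda>n. (1/2) *\<^sub>R (y n + x'))"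
  shows "limitin weak_star_topology y x' sequentially"
  unfolding limitin_weak_star_iff
proof (rule allI, rule ccontr)
  fix x
  assume "\<not> (\<lambda>n. blinfun_apply (y n) x) \<longlonglongrightarrow> blinfun_apply x' x"
  then obtain e where e: "0 < e"
    and freq: "\<exists>\<^sub>F n in sequentially. \<not> dist (blinfun_apply (y n) x) (blinfun_apply x' x) < e"
    unfolding tendsto_iff frequently_def by auto
  \<comment> \<open>The indices at which convergence at \<open>x\<close> fails by \<open>e\<close>.
    A cluster functional \<open>l\<close> taken inside \<open>S\<close> stays away from
    \<open>x'\<close> at \<open>x\<close>, which will contradict \<open>l = x'\<close>.\<close>
  define S where "S = {n. e \<le> dist (blinfun_apply (y n) x) (blinfun_apply x' x)}"
  have "inf sequentially (principal S) \<noteq> bot"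
    using freq unfolding trivial_limit_def eventually_inf_principal frequently_def S_def
    by (simp add: not_less)
  moreover have y1: "norm (y n) \<le> 1" for n using y by (simp add: image_subset_iff)
  ultimately obtain l G where G: "G \<noteq> bot" "G \<le> inf sequentially (principal S)"
    and l: "norm l \<le> 1" and lim: "\<And>z. ((\<lambda>n. blinfun_apply (y n) z) \<longlongrightarrow> blinfun_apply l z) G"
    using banach_alaoglu_subfilter[of _ y] by metis
  have x1: "norm x' = 1" using rot by (simp add: rotund_point_def)
  have GS: "G \<le> sequentially" "G \<le> principal S"
    using G(2) by simp_all
  have evS: "eventually (\<lambda>n. n \<in> S) G"
    by (rule filter_leD[OF GS(2)]) (simp add: eventually_principal)
  \<comment> \<open>For each \<epsilon> a single vector \<open>z\<close> serves all large
    \<open>n\<close>, so the inequality survives the limit along \<open>G\<close>.\<close>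
  have "1 - \<epsilon> \<le> norm ((1/2) *\<^sub>R (x' + l))" if eps: "0 < \<epsilon>" for \<epsilon>
  proof -
    obtain z N where z: "norm z \<le> 1"
      and N: "\<forall>n\<ge>N. 1 - \<epsilon> < blinfun_apply ((1/2) *\<^sub>R (y n + x')) z"
      using asym eps unfolding asymptotically_normed_def mem_cball_0 Bex_def by blast
    have "((\<lambda>n. blinfun_apply ((1/2) *\<^sub>R (y n + x')) z)
        \<longlongrightarrow> (1/2) * (blinfun_apply l z + blinfun_apply x' z)) G"
      unfolding blinfun.scaleR_left blinfun.add_left real_scaleR_def by (intro tendsto_intros lim)
    moreover have "eventually (\<lambda>n. 1 - \<epsilon> \<le> blinfun_apply ((1/2) *\<^sub>R (y n + x')) z) G"
      by (rule filter_leD[OF GS(1)], rule eventually_sequentiallyI[of N]) (use N in \<open>auto intro: less_imp_le\<close>)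
    ultimately have "1 - \<epsilon> \<le> (1/2) * (blinfun_apply l z + blinfun_apply x' z)"
      using G(1) tendsto_lowerbound by blast
    also have "\<dots> = blinfun_apply ((1/2) *\<^sub>R (x' + l)) z"
      by (simp add: blinfun.scaleR_left blinfun.add_left)
    also have "\<dots> \<le> norm ((1/2) *\<^sub>R (x' + l)) * norm z"
      using norm_blinfun[of "(1/2) *\<^sub>R (x' + l)" z] by simp
    also have "\<dots> \<le> norm ((1/2) *\<^sub>R (x' + l))"
      using z by (intro mult_left_le) auto
    finally show ?thesis .
  qed
  then have "1 \<le> norm ((1/2) *\<^sub>R (x' + l))"
    using field_le_epsilon[of 1 "norm ((1/2) *\<^sub>R (x' + l))"] by force
  then have half: "norm ((1/2) *\<^sub>R (x' + l)) = 1"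
    using norm_half_add_le[of x' l] x1 l by simp
  \<comment> \<open>Rotundity compares with unit vectors only; the midpoint forces
    \<open>2 \<le> 1 + norm l\<close>.\<close>
  then have "norm l = 1"
    using norm_triangle_ineq[of x' l] x1 l by simp
  then have "l = x'"
    using rot half by (simp add: rotund_point_def)
  then have "eventually (\<lambda>n. dist (blinfun_apply (y n) x) (blinfun_apply x' x) < e) G"
    using lim[of x] e by (simp add: tendsto_iff)
  with evS have "eventually (\<lambda>_. False) G"
    by eventually_elim (simp add: S_def)
  with G(1) show False by simp
qed

text \<open>The passage between (b) and (b'). Vectors chosen for \<open>1 / real (Suc m)\<close>
  form the sequence; conversely one member with lower limit above \<open>1 - \<epsilon>\<close> is a
  witness for \<epsilon>.\<close>

lemma asymptotically_normed_iff_liminf: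
  fixes z :: "nat \<Rightarrow> ('a::real_normed_vector \<Rightarrow>\<^sub>L real)"
  assumes z: "range z \<subseteq> cball 0 1"
  shows "asymptotically_normed z \<longleftrightarrow>
    (\<exists>x. range x \<subseteq> cball 0 1 \<and>
      (\<lambda>m. liminf (\<lambda>n. ereal (blinfun_apply (z n) (x m)))) \<longlonglongrightarrow> 1)"
proof
  assume "asymptotically_normed z"
  then have "\<exists>x. norm x \<le> 1 \<and> (\<exists>N. \<forall>n\<ge>N. 1 - 1 / real (Suc m) < blinfun_apply (z n) x)" for m
    unfolding asymptotically_normed_def by (auto simp: Bex_def dest!: spec[of _ "1 / real (Suc m)"])
  then obtain x where x: "\<And>m. norm (x m) \<le> 1"
    and N: "\<And>m. \<exists>N. \<forall>n\<ge>N. 1 - 1 / real (Suc m) < blinfun_apply (z n) (x m)"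
    by metis
  have "(\<lambda>m. liminf (\<lambda>n. ereal (blinfun_apply (z n) (x m)))) \<longlonglongrightarrow> 1"
  proof (rule tendsto_sandwich)
    show "\<forall>\<^sub>F m in sequentially.
        ereal (1 - 1 / real (Suc m)) \<le> liminf (\<lambda>n. ereal (blinfun_apply (z n) (x m)))"
    proof (rule always_eventually, rule allI, rule Liminf_bounded)
      fix m
      show "\<forall>\<^sub>F n in sequentially. ereal (1 - 1 / real (Suc m)) \<le> ereal (blinfun_apply (z n) (x m))"
        using N[of m] by (auto simp: eventually_sequentially intro: less_imp_le)
    qed
    have "blinfun_apply (z n) (x m) \<le> 1" for n m
      using blinfun_le_norm[of "z n" "x m"] z x[of m] by (auto simp: image_subset_iff intro: order_trans)
    then show "\<forall>\<^sub>F m in sequentially. liminf (\<lambda>n. ereal (blinfun_apply (z n) (x m))) \<le> 1"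
      by (intro always_eventually allI Liminf_le) (auto simp: one_ereal_def)
    have "(\<lambda>m. 1 - 1 / real (Suc m)) \<longlonglongrightarrow> 1 - 0"
      by (intro tendsto_intros LIMSEQ_Suc[OF lim_1_over_n])
    then show "(\<lambda>m. ereal (1 - 1 / real (Suc m))) \<longlonglongrightarrow> 1"
      by (simp add: one_ereal_def)
  qed simp
  then show "\<exists>x. range x \<subseteq> cball 0 1 \<and>
      (\<lambda>m. liminf (\<lambda>n. ereal (blinfun_apply (z n) (x m)))) \<longlonglongrightarrow> 1"
    using x by (intro exI[of _ x]) auto
next
  assume "\<exists>x. range x \<subseteq> cball 0 1 \<and>
      (\<lambda>m. liminf (\<lambda>n. ereal (blinfun_apply (z n) (x m)))) \<longlonglongrightarrow> 1"
  then obtain x where x: "range x \<subseteq> cball 0 1"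
    and lim: "(\<lambda>m. liminf (\<lambda>n. ereal (blinfun_apply (z n) (x m)))) \<longlonglongrightarrow> 1" by blast
  have "\<exists>x\<in>cball 0 1. \<exists>N. \<forall>n\<ge>N. 1 - \<epsilon> < blinfun_apply (z n) x" if "0 < \<epsilon>" for \<epsilon>
  proof -
    have "ereal (1 - \<epsilon>) < 1" using that by (simp add: one_ereal_def)
    from eventually_happens[OF order_tendstoD(1)[OF lim this]]
    obtain m where "ereal (1 - \<epsilon>) < liminf (\<lambda>n. ereal (blinfun_apply (z n) (x m)))"
      by auto
    then have "\<forall>\<^sub>F n in sequentially. ereal (1 - \<epsilon>) < ereal (blinfun_apply (z n) (x m))"
      by (rule less_LiminfD)
    then show ?thesis using x by (auto simp: eventually_sequentially)
  qed
  with z show "asymptotically_normed z" by (simp add: asymptotically_normed_def)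
qed

text \<open>Both functionals are almost \<open>1\<close> at the rescaled centres \<open>(c n - c 0) / r n\<close>,
  uniformly in the index of \<open>y\<close> from \<open>n\<close> on.\<close>

lemma nested_balls_asymptotically_normed:
  fixes x' :: "'a::real_normed_vector \<Rightarrow>\<^sub>L real"
  assumes x': "norm x' = 1" and B: "unbounded_nested_balls B"
    and below: "bounded_below_on x' (\<Union>n. B n)"
    and y: "\<And>n. norm (y n) = 1"
    and y_bound: "\<And>n z. z \<in> B n \<Longrightarrow> M \<le> blinfun_apply (y n) z"
  shows "asymptotically_normed (\<lambda>n. (1/2) *\<^sub>R (y n + x'))"
proof -
  obtain c r where r: "\<And>n. 0 < r n" and ball: "\<And>n. B n = ball (c n) (r n)"
    and inc: "incseq B" and lim: "filterlim r at_top sequentially"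
    using B unfolding unbounded_nested_balls_def by blast
  obtain M' where M': "\<And>n z. z \<in> B n \<Longrightarrow> M' \<le> blinfun_apply x' z"
    using below unfolding bounded_below_on_iff bdd_below_def by auto
  have x'_c: "M' + r n \<le> blinfun_apply x' (c n)" for n
    using M'[of _ n] by (intro blinfun_center_ge[OF x' r]) (simp add: ball)
  \<comment> \<open>As \<open>B n \<subseteq> B k\<close>, the bound for \<open>y k\<close> holds on
    the earlier ball too, so one centre serves all later functionals.\<close>
  have y_c: "M + r n \<le> blinfun_apply (y k) (c n)" if "n \<le> k" for n k
  proof (rule blinfun_center_ge[OF y r])
    fix z assume "z \<in> ball (c n) (r n)"
    then have "z \<in> B k" using incseqD[OF inc that] ball[of n] by blast
    then show "M \<le> blinfun_apply (y k) z" by (rule y_bound)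
  qed
  \<comment> \<open>\<open>L\<close> collects the errors: the mean of the two lower bounds, and the
    cost of shifting the centres by \<open>c 0\<close>.\<close>
  define L where "L = (M + M') / 2 - norm (c 0)"
  have "\<exists>x\<in>cball 0 1. \<exists>N. \<forall>k\<ge>N. 1 - \<epsilon> < blinfun_apply ((1/2) *\<^sub>R (y k + x')) x" if \<epsilon>: "0 < \<epsilon>" for \<epsilon>
  proof -
    have "\<forall>\<^sub>F n in sequentially. - L / \<epsilon> < r n"
      using lim by (simp add: filterlim_at_top_dense)
    then obtain n where n: "- L / \<epsilon> < r n"
      by (auto simp: eventually_sequentially)
    define u where "u = (1 / r n) *\<^sub>R (c n - c 0)"
    have "c 0 \<in> B n" using incseqD[OF inc, of 0 n] ball[of 0] r[of 0] by auto
    then have "norm u \<le> 1" using r[of n] by (simp add: u_def ball dist_norm norm_minus_commute del: scaleR_right_diff_distrib)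
    moreover have "1 - \<epsilon> < blinfun_apply ((1/2) *\<^sub>R (y k + x')) u" if k: "n \<le> k" for k
    proof -
      have "blinfun_apply ((1/2) *\<^sub>R (y k + x')) (c 0) \<le> norm (c 0)"
        by (intro blinfun_le_norm norm_half_add_le) (simp_all add: y x')
      moreover have "(M + M') / 2 + r n \<le> blinfun_apply ((1/2) *\<^sub>R (y k + x')) (c n)"
        using y_c[OF k] x'_c[of n] by (simp add: blinfun.scaleR_left blinfun.add_left field_simps)
      ultimately have "L + r n \<le> blinfun_apply ((1/2) *\<^sub>R (y k + x')) (c n - c 0)"
        by (simp add: L_def blinfun.diff_right)
      also have "\<dots> = r n * blinfun_apply ((1/2) *\<^sub>R (y k + x')) u"
        unfolding u_def using r[of n] by (simp only: blinfun.scaleR_right) simp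
      finally have "L + r n \<le> r n * blinfun_apply ((1/2) *\<^sub>R (y k + x')) u" .
      moreover have "r n * (1 - \<epsilon>) < L + r n"
        using n \<epsilon> by (simp add: field_simps)
      ultimately show ?thesis
        using r[of n] by (meson less_le_trans mult_less_cancel_left_pos)
    qed
    ultimately show ?thesis by (intro bexI[of _ u] exI[of _ n]) auto
  qed
  moreover have "range (\<lambda>n. (1/2) *\<^sub>R (y n + x')) \<subseteq> cball 0 1"
    using norm_half_add_le[OF eq_refl[OF y] eq_refl[OF x']] by (simp add: image_subset_iff)
  ultimately show ?thesis unfolding asymptotically_normed_def by blast
qed

text \<open>The centres are partial sums of vectors at which both functionals are within \<open>(1/2) ^ Suc n\<close>
  of \<open>1\<close>; these errors are summable.\<close>

lemma exists_common_nested_balls: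
  fixes x' y' :: "'a::real_normed_vector \<Rightarrow>\<^sub>L real"
  assumes x': "norm x' = 1" and y': "norm y' = 1" and mid: "norm ((1/2) *\<^sub>R (x' + y')) = 1"
  obtains B where "unbounded_nested_balls B" "bounded_below_on x' (\<Union>n. B n)"
    "bounded_below_on y' (\<Union>n. B n)"
proof -
  have "\<exists>u. norm u \<le> 1 \<and> 1 - (1/2) ^ Suc n \<le> blinfun_apply x' u
      \<and> 1 - (1/2) ^ Suc n \<le> blinfun_apply y' u" for n
  proof -
    \<comment> \<open>At \<open>u\<close> both functionals are at most \<open>1\<close>, so the
      deficit of each is at most twice that of the midpoint; the extra \<open>Suc\<close> absorbs
      this factor.\<close>
    have "1 - (1/2) ^ Suc (Suc n) < norm ((1/2) *\<^sub>R (x' + y'))" by (simp only: mid) simp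
    then obtain u where u: "norm u \<le> 1"
      "1 - (1/2) ^ Suc (Suc n) < blinfun_apply ((1/2) *\<^sub>R (x' + y')) u"
      by (rule exists_almost_norming)
    have "blinfun_apply x' u \<le> 1" "blinfun_apply y' u \<le> 1"
      using blinfun_le_norm[of x' u] blinfun_le_norm[of y' u] x' y' u(1) by auto
    then show ?thesis
      using u by (intro exI[of _ u]) (auto simp: blinfun.scaleR_left blinfun.add_left)
  qed
  then obtain u where u: "\<And>n. norm (u n) \<le> 1"
    and ux: "\<And>n. 1 - (1/2) ^ Suc n \<le> blinfun_apply x' (u n)"
    and uy: "\<And>n. 1 - (1/2) ^ Suc n \<le> blinfun_apply y' (u n)" by metis
  define c where "c n = (\<Sum>k<n. u k)" for n
  \<comment> \<open>The centre moves by at most \<open>1\<close> per step, matching the growth of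
    the radius; the summand \<open>1\<close> keeps the first radius positive.\<close>
  define B where "B n = ball (c n) (real n + 1)" for n
  have "B n \<subseteq> B (Suc n)" for n
  proof
    fix z assume "z \<in> B n"
    moreover have "dist (c (Suc n)) (c n) \<le> 1" using u[of n] by (simp add: c_def dist_norm)
    ultimately show "z \<in> B (Suc n)"
      using dist_triangle[of "c (Suc n)" z "c n"] by (simp add: B_def)
  qed
  then have "incseq B" by (rule incseq_SucI)
  moreover have "filterlim (\<lambda>n. real n + 1) at_top sequentially"
    using filterlim_real_sequentially
    by (rule filterlim_at_top_mono) auto
  ultimately have "unbounded_nested_balls B"
    unfolding unbounded_nested_balls_def
    by (intro exI[of _ c] exI[of _ "\<lambda>n. real n + 1"]) (auto simp: B_def incseq_def)
  moreover have "bounded_below_on f (\<Union>n. B n)"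
    if f: "norm f = 1" and fu: "\<And>n. 1 - (1/2) ^ Suc n \<le> blinfun_apply f (u n)"
    for f :: "'a \<Rightarrow>\<^sub>L real"
  proof -
    \<comment> \<open>The deficits \<open>(1/2) ^ Suc k\<close> for \<open>k < n\<close> add up to
      \<open>1 - (1/2) ^ n\<close>. Subtracting the radius \<open>real n + 1\<close> then leaves the
      bound \<open>- 2\<close>.\<close>
    have c: "real n - 1 + (1/2) ^ n \<le> blinfun_apply f (c n)" for n
    proof (induction n)
      case (Suc n)
      then show ?case using fu[of n] by (simp add: c_def blinfun.add_right)
    qed (simp add: c_def)
    have "- 2 \<le> blinfun_apply f z" if "z \<in> B n" for n z
    proof -
      have "blinfun_apply f (c n) - (real n + 1) \<le> blinfun_apply f z"
        using f that by (intro blinfun_lower_bound_ball) (auto simp: B_def)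
      moreover have "0 < (1/2 :: real) ^ n" by simp
      ultimately show ?thesis using c[of n] by linarith
    qed
    then show ?thesis unfolding bounded_below_on_iff by (intro bdd_belowI[of _ "- 2"]) auto
  qed
  ultimately show ?thesis using that x' y' ux uy by blast
qed

text \<open>A point \<open>z\<close> outside all the balls is separated from \<open>B n\<close> by a functional \<open>y n\<close> norming
  \<open>c n - z\<close>. In the weak* limit \<open>x'\<close> separates \<open>z\<close> from the whole union.\<close>

lemma blinfun_le_on_nested_balls:
  fixes x' :: "'a::real_normed_vector \<Rightarrow>\<^sub>L real"
  assumes B: "unbounded_nested_balls B"
    and conv: "\<And>y. range y \<subseteq> sphere 0 1 \<Longrightarrow>
      bdd_below (range (\<lambda>n. INF z\<in>B n. blinfun_apply (y n) z)) \<Longrightarrow>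
      limitin weak_star_topology y x' sequentially"
    and z: "z \<notin> (\<Union>n. B n)" and w: "w \<in> (\<Union>n. B n)"
  shows "blinfun_apply x' z \<le> blinfun_apply x' w"
proof -
  obtain c r where r: "\<And>n. 0 < r n" and ball: "\<And>n. B n = ball (c n) (r n)" and inc: "incseq B"
    using B unfolding unbounded_nested_balls_def by blast
  have far: "r n \<le> norm (c n - z)" for n
    using z by (auto simp: ball dist_norm not_less)
  then have "c n - z \<noteq> 0" for n using r[of n] by (metis norm_zero not_less)
  then have "\<exists>f :: 'a \<Rightarrow>\<^sub>L real. norm f = 1 \<and> blinfun_apply f (c n - z) = norm (c n - z)" for n
    using norming_functional by metis
  then obtain y :: "nat \<Rightarrow> ('a \<Rightarrow>\<^sub>L real)" where y: "\<And>n. norm (y n) = 1"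
    and yz: "\<And>n. blinfun_apply (y n) (c n - z) = norm (c n - z)" by metis
  have sep: "blinfun_apply (y n) z \<le> blinfun_apply (y n) v" if "v \<in> B n" for n v
    using blinfun_lower_bound_ball[of "y n" v "c n" "r n"] that far[of n] yz[of n] y[of n]
    by (simp add: ball blinfun.diff_right)
  \<comment> \<open>A bound independent of \<open>n\<close>; \<open>sep\<close> carries it to the
    infimum over \<open>B n\<close>, as \<open>conv\<close> requires.\<close>
  have "- norm z \<le> blinfun_apply (y n) z" for n
    using blinfun_le_norm[of "y n" "- z"] y[of n] by (simp add: blinfun.minus_right)
  then have "- norm z \<le> (INF v\<in>B n. blinfun_apply (y n) v)" for n
    using sep[of _ n] r[of n] by (intro cINF_greatest) (auto simp: ball intro: order_trans)
  then have "bdd_below (range (\<lambda>n. INF v\<in>B n. blinfun_apply (y n) v))"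
    by (intro bdd_belowI[of _ "- norm z"]) auto
  then have "limitin weak_star_topology y x' sequentially"
    using y by (intro conv) auto
  then have lim: "(\<lambda>n. blinfun_apply (y n) v) \<longlonglongrightarrow> blinfun_apply x' v" for v
    unfolding limitin_weak_star_iff by blast
  obtain m where m: "w \<in> B m" using w by blast
  have "blinfun_apply (y n) z \<le> blinfun_apply (y n) w" if "m \<le> n" for n
    using sep[of w n] m incseqD[OF inc that] by blast
  then show ?thesis by (intro LIMSEQ_le[OF lim lim]) blast
qed

text \<open>The half-space is cut at the infimum of \<open>x'\<close> over the union. It is not
  attained because the balls are open, and \<open>le\<close> keeps outside points at or below
  it.\<close>

lemma affine_half_space_of_complement_le:
  fixes x' :: "'a::real_normed_vector \<Rightarrow>\<^sub>L real"
  assumes x': "norm x' = 1" and B: "unbounded_nested_balls B"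
    and below: "bounded_below_on x' (\<Union>n. B n)"
    and le: "\<And>z w. z \<notin> (\<Union>n. B n) \<Longrightarrow> w \<in> (\<Union>n. B n) \<Longrightarrow> blinfun_apply x' z \<le> blinfun_apply x' w"
  shows "affine_half_space x' (\<Union>n. B n)"
proof -
  let ?U = "\<Union>n. B n"
  obtain c r where r: "\<And>n. 0 < r n" and ball: "\<And>n. B n = ball (c n) (r n)"
    using B unfolding unbounded_nested_balls_def by blast
  define \<alpha> where "\<alpha> = (INF z\<in>?U. blinfun_apply x' z)"
  have bdd: "bdd_below (blinfun_apply x' ` ?U)"
    using below by (simp add: bounded_below_on_iff)
  have ne: "?U \<noteq> {}" using r[of 0] ball[of 0] by (metis UN_I UNIV_I centre_in_ball empty_iff)
  have "?U = {z. \<alpha> < blinfun_apply x' z}"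
  proof (intro equalityI subsetI CollectI)
    fix w assume "w \<in> ?U"
    then obtain n where n: "w \<in> B n" by blast
    have "\<alpha> \<le> blinfun_apply x' z" if "z \<in> B n" for z
      unfolding \<alpha>_def using that by (intro cINF_lower[OF bdd]) blast
    then show "\<alpha> < blinfun_apply x' w"
      using blinfun_gt_Inf_ball[OF x', of w "c n" "r n" \<alpha>] n by (simp add: ball)
  next
    fix z assume z: "z \<in> {z. \<alpha> < blinfun_apply x' z}"
    show "z \<in> ?U"
    proof (rule ccontr)
      assume "z \<notin> ?U"
      then have "blinfun_apply x' z \<le> \<alpha>"
        unfolding \<alpha>_def using le ne by (intro cINF_greatest) auto
      with z show False by simp
    qed
  qed
  then show ?thesis unfolding affine_half_space_def by blast
qed

text \<open>A ray from a point of \<open>U\<close> in a direction where \<open>x'\<close> is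
  nonnegative stays in \<open>U\<close>, so \<open>y'\<close> is nonnegative there too. Hence
  \<open>y'\<close> vanishes on the kernel of \<open>x'\<close>.\<close>

lemma bounded_below_on_half_space_unique:
  fixes x' y' :: "'a::real_normed_vector \<Rightarrow>\<^sub>L real"
  assumes x': "norm x' = 1" and y': "norm y' = 1"
    and U: "affine_half_space x' U" and below: "bounded_below_on y' U"
  shows "y' = x'"
proof -
  obtain \<alpha> where \<alpha>: "U = {x. \<alpha> < blinfun_apply x' x}"
    using U unfolding affine_half_space_def by blast
  obtain M where M: "\<And>x. \<alpha> < blinfun_apply x' x \<Longrightarrow> M \<le> blinfun_apply y' x"
    using below unfolding bounded_below_on_iff \<alpha> bdd_below_def by auto
  obtain h where "0 < blinfun_apply x' h"
    using exists_almost_norming[of 0 x'] x' by auto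
  define e where "e = (1 / blinfun_apply x' h) *\<^sub>R h"
  have e: "blinfun_apply x' e = 1"
    using \<open>0 < blinfun_apply x' h\<close> by (simp add: e_def blinfun.scaleR_right)
  have nonneg: "0 \<le> blinfun_apply y' x" if x: "0 \<le> blinfun_apply x' x" for x
  proof (rule ccontr)
    assume neg: "\<not> ?thesis"
    \<comment> \<open>\<open>x'\<close> has the value \<open>\<alpha> + 1\<close> at
      \<open>p\<close>, and \<open>t\<close> is so large that \<open>y'\<close> is at most
      \<open>M - 1\<close> at \<open>p + t *\<^sub>R x\<close>.\<close>
    define p where "p = (\<alpha> + 1) *\<^sub>R e"
    define t where "t = (\<bar>blinfun_apply y' p - M\<bar> + 1) / (- blinfun_apply y' x)"
    have neg': "0 < - blinfun_apply y' x" using neg by simp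
    have t: "0 \<le> t"
      unfolding t_def using neg' by (intro divide_nonneg_pos) auto
    have "t * - blinfun_apply y' x = \<bar>blinfun_apply y' p - M\<bar> + 1"
      unfolding t_def using neg' by (intro nonzero_eq_divide_eq[THEN iffD1]) auto
    then have t': "t * blinfun_apply y' x = - (\<bar>blinfun_apply y' p - M\<bar> + 1)"
      by linarith
    have "\<alpha> < blinfun_apply x' (p + t *\<^sub>R x)"
      using mult_nonneg_nonneg[OF t x]
      by (simp add: p_def blinfun.add_right blinfun.scaleR_right e)
    from M[OF this] have "M \<le> blinfun_apply y' p + t * blinfun_apply y' x"
      by (simp add: blinfun.add_right blinfun.scaleR_right)
    then show False using t' by linarith
  qed
  define s where "s = blinfun_apply y' e"
  have "blinfun_apply y' x = s * blinfun_apply x' x" for x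
  proof -
    \<comment> \<open>The projection of \<open>x\<close> onto the kernel of \<open>x'\<close> along
      \<open>e\<close>; \<open>nonneg\<close> applies to both \<open>k\<close> and
      \<open>- k\<close>.\<close>
    define k where "k = x - blinfun_apply x' x *\<^sub>R e"
    have "blinfun_apply x' k = 0" by (simp add: k_def blinfun.diff_right blinfun.scaleR_right e)
    then have "blinfun_apply y' k = 0"
      using nonneg[of k] nonneg[of "- k"] by (simp add: blinfun.minus_right)
    then show ?thesis by (simp add: k_def blinfun.diff_right blinfun.scaleR_right s_def)
  qed
  then have eq: "y' = s *\<^sub>R x'"
    by (intro blinfun_eqI) (simp add: blinfun.scaleR_left)
  then have "\<bar>s\<bar> = 1" using x' y' by simp
  moreover have "0 \<le> s" unfolding s_def using e by (intro nonneg) simp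
  ultimately show ?thesis using eq by simp
qed

(* In (c) the real-valued infimum is the true one: each B n is a ball, hence nonempty and bounded. *)
theorem theoremE:
  fixes x' :: "'a::banach \<Rightarrow>\<^sub>L real"
  assumes "x' \<in> sphere 0 1"
  defines "a \<equiv> rotund_point x'"
    and "b \<equiv> weak_star_ALUR_point x'"
    and "b' \<equiv> (\<forall>y. range y \<subseteq> cball 0 1 \<and> asymptotically_normed (\<lambda>n. (1/2) *\<^sub>R (y n + x'))
      \<longrightarrow> limitin weak_star_topology y x' sequentially)"
    and "c \<equiv> (\<forall>B. unbounded_nested_balls B \<and> bounded_below_on x' (\<Union>n. B n) \<longrightarrow>
      (\<forall>y. range y \<subseteq> sphere 0 1 \<and> bdd_below (range (\<lambda>n. INF z\<in>B n. blinfun_apply (y n) z))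
        \<longrightarrow> limitin weak_star_topology y x' sequentially))"
    and "d \<equiv> (\<forall>B. unbounded_nested_balls B \<and> bounded_below_on x' (\<Union>n. B n) \<longrightarrow>
      (\<forall>y. y \<in> sphere 0 1 \<and> bounded_below_on y (\<Union>n. B n) \<longrightarrow> y = x'))"
    and "e \<equiv> (\<forall>B. unbounded_nested_balls B \<and> bounded_below_on x' (\<Union>n. B n) \<longrightarrow>
      affine_half_space x' (\<Union>n. B n))"
  shows "(a \<longleftrightarrow> b) \<and> (b \<longleftrightarrow> b') \<and> (b' \<longleftrightarrow> c) \<and> (c \<longleftrightarrow> d) \<and> (d \<longleftrightarrow> e)"
proof -
  have x': "norm x' = 1" using assms(1) by simp
  have "a \<Longrightarrow> b'"
    unfolding a_def b'_def using rotund_point_asymptotically_normed by blast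
  moreover have "b = b'"
  proof -
    have "range (\<lambda>n. (1/2) *\<^sub>R (y n + x')) \<subseteq> cball 0 1" if "range y \<subseteq> cball 0 1" for y :: "nat \<Rightarrow> _"
      using that norm_half_add_le[of _ x'] x' by (auto simp: image_subset_iff)
    from asymptotically_normed_iff_liminf[OF this] show ?thesis
      unfolding b_def b'_def weak_star_ALUR_point_def by blast
  qed
  moreover have "c" if b'
    unfolding c_def
  proof (intro allI impI, elim conjE)
    fix B and y :: "nat \<Rightarrow> ('a \<Rightarrow>\<^sub>L real)"
    assume B: "unbounded_nested_balls B" and below: "bounded_below_on x' (\<Union>n. B n)"
      and y: "range y \<subseteq> sphere 0 1"
      and bdd: "bdd_below (range (\<lambda>n. INF z\<in>B n. blinfun_apply (y n) z))"
    have y1: "norm (y n) = 1" for n using subsetD[OF y rangeI, of n] by simp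
    obtain M where M: "\<And>n. M \<le> (INF z\<in>B n. blinfun_apply (y n) z)"
      using bdd by (auto simp: bdd_below_def)
    obtain c r where ball: "\<And>n. B n = ball (c n) (r n)"
      using B unfolding unbounded_nested_balls_def by blast
    have "M \<le> blinfun_apply (y n) z" if z: "z \<in> B n" for n z
    proof -
      \<comment> \<open>The values on the ball are bounded below, so the bound \<open>M\<close> on
        their real infimum passes to each value.\<close>
      have "bdd_below (blinfun_apply (y n) ` B n)"
        using blinfun_lower_bound_ball[of "y n" _ "c n" "r n"] y1[of n]
        by (intro bdd_belowI[of _ "blinfun_apply (y n) (c n) - r n"]) (auto simp: ball)
      from cINF_lower[OF this z] M[of n] show ?thesis by (rule order_trans[rotated])
    qed
    then have "asymptotically_normed (\<lambda>n. (1/2) *\<^sub>R (y n + x'))"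
      by (rule nested_balls_asymptotically_normed[OF x' B below y1])
    moreover have "range y \<subseteq> cball 0 1" using y1 by auto
    ultimately show "limitin weak_star_topology y x' sequentially"
      using that unfolding b'_def by blast
  qed
  moreover have "e" if c
    unfolding e_def
  proof (intro allI impI, elim conjE)
    fix B assume B: "unbounded_nested_balls B" and below: "bounded_below_on x' (\<Union>n. B n)"
    then have "limitin weak_star_topology y x' sequentially"
      if "range y \<subseteq> sphere 0 1" "bdd_below (range (\<lambda>n. INF z\<in>B n. blinfun_apply (y n) z))" for y
      using \<open>c\<close> that unfolding c_def by blast
    from blinfun_le_on_nested_balls[OF B this]
    show "affine_half_space x' (\<Union>n. B n)"
      by (rule affine_half_space_of_complement_le[OF x' B below])
  qed
  moreover have "d" if e
    using that bounded_below_on_half_space_unique[OF x'] unfolding d_def e_def by auto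
  moreover have "a" if d
    unfolding a_def rotund_point_def
  proof (intro conjI allI impI)
    fix y assume "norm y = 1 \<and> norm ((1/2) *\<^sub>R (x' + y)) = 1"
    then obtain B where "unbounded_nested_balls B" "bounded_below_on x' (\<Union>n. B n)"
      "bounded_below_on y (\<Union>n. B n)" "y \<in> sphere 0 1"
      using exists_common_nested_balls[OF x', of y] by auto
    with that show "y = x'" unfolding d_def by blast
  qed (rule assms(1))
  ultimately show ?thesis by blast
qed

end
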